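(* Let $\Gamma=(V,E)$ be a connected simple graph and let $\mathcal{G}$ be its normalized Green's function. Then for all $u,v\in V$, $$\mathcal{G}(u,v)=\frac{\sqrt{d_ud_v}}{\mathrm{vol}^2(\Gamma)\,\tau}\Big(\sum_{\substack{T_1 \cup T_2 \in \mathbb{F}_2\\ u,v\in T_1}}\mathrm{vol}^2(T_2)-\sum_{\substack{T_1 \cup T_2 \in \mathbb{F}_2\\ u\in T_1,\ v\in T_2}}\mathrm{vol}(T_1)\,\mathrm{vol}(T_2)\Big),$$ where $\tau$ is the number of (unrooted) spanning trees of $\Gamma$ and $\mathbb{F}_2$ denotes the family of (unrooted) spanning $2$-forests of $\Gamma$.
   Context: $\Gamma$ is a finite undirected simple unweighted graph with at least two vertices, with adjacency matrix $A$, degrees $d_u$, and $D=\mathrm{Diag}[d_u]$. The normalized Laplacian is $\mathcal{L}=D^{-1/2}(D-A)D^{-1/2}$ and the normalized Green's function $\mathcal{G}$ is the Moore–Penrose pseudoinverse of $\mathcal{L}$. For a set $U$ of vertices $\mathrm{vol}(U)=\sum_{z\in U}d_z$ with degrees taken in $\Gamma$; for a subgraph $T$, $\mathrm{vol}(T)$ is the volume of its vertex set, and $\mathrm{vol}(\Gamma)=\mathrm{vol}(V)$; $\mathrm{vol}^2(\cdot)$ means $(\mathrm{vol}(\cdot))^2$. A spanning $2$-forest is a subgraph containing all vertices of $\Gamma$, with no cycles and exactly two connected components; it is written $T_1\cup T_2$, where $T_1,T_2$ are its components. The order of $T_1$ and $T_2$ is irrelevant: a sum ranges over forests, each counted once,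 with the components named so that the condition under the sum holds. *)

theory Defs
  imports "HOL-Analysis.Analysis"
begin

text \<open>
  An undirected graph has a finite type \<open>'v\<close> as its vertex set and is given by its set of edges,
  each edge being a two-element set of vertices. A spanning subgraph is a subset of the edges.
\<close>

definition simple_graph :: "'v set set \<Rightarrow> bool" where
  "simple_graph E \<longleftrightarrow> (\<forall>e\<in>E. card e = 2)"

definition graph_reachable :: "'v set set \<Rightarrow> ('v \<times> 'v) set" where
  "graph_reachable E = {(x, y). {x, y} \<in> E}\<^sup>*"

definition connected_graph :: "'v set set \<Rightarrow> bool" where
  "connected_graph E \<longleftrightarrow> (\<forall>u v. (u, v) \<in> graph_reachable E)"

text \<open>Connected components, identified with their vertex sets.\<close>

definition graph_components :: "'v set set \<Rightarrow> 'v set set" where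
  "graph_components E = UNIV // graph_reachable E"

definition graph_cycle :: "'v set set \<Rightarrow> 'v list \<Rightarrow> bool" where
  "graph_cycle E p \<longleftrightarrow> length p \<ge> 3 \<and> distinct p \<and>
     (\<forall>i<length p. {p ! i, p ! ((i + 1) mod length p)} \<in> E)"

definition acyclic_graph :: "'v set set \<Rightarrow> bool" where
  "acyclic_graph E \<longleftrightarrow> (\<nexists>p. graph_cycle E p)"

definition spanning_trees :: "'v set set \<Rightarrow> 'v set set set" where
  "spanning_trees E = {F. F \<subseteq> E \<and> acyclic_graph F \<and> connected_graph F}"

definition spanning_2forests :: "'v set set \<Rightarrow> 'v set set set" where
  "spanning_2forests E = {F. F \<subseteq> E \<and> acyclic_graph F \<and> card (graph_components F) = 2}"

text \<open>
  Spanning 2-forests together with a naming of their two components. Every forest occurs here with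
  both namings; requiring a given vertex to lie in \<open>T\<^sub>1\<close> selects exactly one of them.
\<close>

definition named_2forests :: "'v set set \<Rightarrow> ('v set set \<times> 'v set \<times> 'v set) set" where
  "named_2forests E = {(F, T\<^sub>1, T\<^sub>2). F \<in> spanning_2forests E \<and> graph_components F = {T\<^sub>1, T\<^sub>2}}"

definition vertex_degree :: "'v set set \<Rightarrow> 'v \<Rightarrow> nat" where
  "vertex_degree E u = card {e \<in> E. u \<in> e}"

definition vol :: "'v set set \<Rightarrow> 'v set \<Rightarrow> nat" where
  "vol E U = (\<Sum>z\<in>U. vertex_degree E z)"

definition diag_matrix :: "('v \<Rightarrow> real) \<Rightarrow> real ^ 'v ^ 'v" where
  "diag_matrix f = (\<chi> i j. if i = j then f i else 0)"

definition adjacency_matrix :: "'v set set \<Rightarrow> real ^ 'v ^ 'v" where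
  "adjacency_matrix E = (\<chi> u v. if {u, v} \<in> E then 1 else 0)"

definition degree_matrix :: "'v set set \<Rightarrow> real ^ 'v ^ 'v" where
  "degree_matrix E = diag_matrix (\<lambda>u. real (vertex_degree E u))"

text \<open>
  In a connected graph with at least two vertices all degrees are positive, so that this really is
  \<open>D\<close> to the power \<open>- 1 / 2\<close>.
\<close>

definition degree_matrix_inv_sqrt :: "'v set set \<Rightarrow> real ^ 'v ^ 'v" where
  "degree_matrix_inv_sqrt E = diag_matrix (\<lambda>u. 1 / sqrt (real (vertex_degree E u)))"

definition normalized_laplacian :: "('v::finite) set set \<Rightarrow> real ^ 'v ^ 'v" where
  "normalized_laplacian E =
     degree_matrix_inv_sqrt E ** (degree_matrix E - adjacency_matrix E) ** degree_matrix_inv_sqrt E"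

definition is_moore_penrose :: "real ^ 'n::finite ^ 'm::finite \<Rightarrow> real ^ 'm ^ 'n \<Rightarrow> bool" where
  "is_moore_penrose M X \<longleftrightarrow>
     M ** X ** M = M \<and> X ** M ** X = X \<and>
     transpose (M ** X) = M ** X \<and> transpose (X ** M) = X ** M"

lemma is_moore_penrose_unique:
  assumes X: "is_moore_penrose M X" and Y: "is_moore_penrose M Y"
  shows "X = Y"
proof -
  have MX: "M ** X = M ** Y"
  proof -
    have "M ** X = transpose (M ** X)" using X by (simp add: is_moore_penrose_def)
    also have "\<dots> = transpose ((M ** Y) ** (M ** X))"
      using Y by (simp add: is_moore_penrose_def matrix_mul_assoc)
    also have "\<dots> = (M ** X) ** (M ** Y)"
      using X Y by (simp add: is_moore_penrose_def matrix_transpose_mul)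
    also have "\<dots> = M ** Y" using X by (simp add: is_moore_penrose_def matrix_mul_assoc)
    finally show ?thesis .
  qed
  have XM: "X ** M = Y ** M"
  proof -
    have "X ** M = transpose (X ** M)" using X by (simp add: is_moore_penrose_def)
    also have "\<dots> = transpose ((X ** M) ** (Y ** M))"
      using Y by (metis is_moore_penrose_def matrix_mul_assoc)
    also have "\<dots> = (Y ** M) ** (X ** M)"
      using X Y by (simp add: is_moore_penrose_def matrix_transpose_mul)
    also have "\<dots> = Y ** M" using X by (metis is_moore_penrose_def matrix_mul_assoc)
    finally show ?thesis .
  qed
  have "X = X ** M ** X" using X by (simp add: is_moore_penrose_def)
  also have "\<dots> = Y ** M ** Y" using MX XM by (metis matrix_mul_assoc)
  also have "\<dots> = Y" using Y by (simp add: is_moore_penrose_def)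
  finally show ?thesis .
qed

definition moore_penrose :: "real ^ 'n::finite ^ 'm::finite \<Rightarrow> real ^ 'm ^ 'n" where
  "moore_penrose M = (THE X. is_moore_penrose M X)"

definition normalized_green :: "('v::finite) set set \<Rightarrow> real ^ 'v ^ 'v" where
  "normalized_green E = moore_penrose (normalized_laplacian E)"

end

theory Submission
  imports Defs
begin

text \<open>
  The Moore--Penrose inverse of the symmetric matrix \<open>\<L>\<close> is the symmetric \<open>X\<close> with
  \<open>\<L> X = I - P\<close> and \<open>P X = 0\<close>, where \<open>P\<close> is the orthogonal projection onto the kernel of \<open>\<L>\<close>
  (\<open>moore_penrose_eq_of_projection\<close>). That kernel is spanned by the vector of the \<open>\<surd>d\<^sub>u\<close>, so
  \<open>P(u,v) = \<surd>(d\<^sub>u d\<^sub>v) / vol(\<Gamma>)\<close>. The proof verifies these equations for the claimed \<open>X\<close>. Writing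
  \<open>X(u,v) = \<surd>(d\<^sub>u d\<^sub>v) K(u,v) / (vol(\<Gamma>)\<^sup>2 \<tau>)\<close>, they concern the combinatorial Laplacian \<open>D - A\<close> and the
  difference \<open>K\<close> of the two sums over forests.

  Fix \<open>v\<close>, and for a spanning 2-forest \<open>F\<close> let \<open>C\<close> be the component of \<open>v\<close> and \<open>C'\<close> the other one.
  The contribution of \<open>F\<close> to \<open>K(u,v)\<close> is \<open>vol(C')\<^sup>2\<close> if \<open>u \<in> C\<close> and \<open>- vol(C) vol(C')\<close> if \<open>u \<in> C'\<close>. Weighted
  by \<open>d\<^sub>u\<close> and summed over \<open>u\<close> these cancel, which gives \<open>P X = 0\<close>. As
  \<open>vol(C) + vol(C') = vol(\<Gamma>)\<close>, the contribution can also be written \<open>vol(C')\<^sup>2 - vol(\<Gamma>) vol(C') [u \<in> C']\<close>.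
  The first term is constant in \<open>u\<close>, hence killed by the Laplacian, and expanding
  \<open>vol(C') = \<Sum>\<^sub>w d\<^sub>w [w \<in> C']\<close> reduces everything to the number \<open>N\<^sub>w(u)\<close> of 2-forests that separate \<open>v\<close> from
  both \<open>u\<close> and \<open>w\<close>.

  The combinatorial heart is Kirchhoff's theorem that \<open>N\<^sub>w\<close> is \<open>\<tau>\<close> times the potential of a unit current
  from \<open>w\<close> to \<open>v\<close>: the sum of \<open>N\<^sub>w(u) - N\<^sub>w(x)\<close> over the neighbours \<open>x\<close> of \<open>u\<close> is
  \<open>\<tau> ([w = u] - [v = u])\<close> (\<open>forest_current_law\<close>). Only forests separating \<open>u\<close> from \<open>x\<close> contribute to
  \<open>N\<^sub>w(u) - N\<^sub>w(x)\<close>, and adding the edge \<open>ux\<close> turns these into the spanning trees through \<open>ux\<close>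
  (\<open>bij_delete_edge\<close>). So the difference counts, with sign, the spanning trees whose path from \<open>w\<close> to \<open>v\<close>
  uses \<open>ux\<close>. In a fixed tree that path is a unit flow, and summing it over the edges
  at \<open>u\<close> gives \<open>[w = u] - [v = u]\<close>.
\<close>

section \<open>Reachability and components\<close>

lemma reach_refl [simp]: "(x, x) \<in> graph_reachable F"
  by (simp add: graph_reachable_def)

lemma reach_sym: "(x, y) \<in> graph_reachable F \<Longrightarrow> (y, x) \<in> graph_reachable F"
proof -
  have "sym {(x, y). {x, y} \<in> F}" by (auto simp: sym_def insert_commute)
  then show "(x, y) \<in> graph_reachable F \<Longrightarrow> (y, x) \<in> graph_reachable F"
    unfolding graph_reachable_def by (meson sym_rtrancl symD)
qed

lemma reach_commute: "(x, y) \<in> graph_reachable F \<longleftrightarrow> (y, x) \<in> graph_reachable F"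
  using reach_sym by metis

lemma reach_trans:
  "(x, y) \<in> graph_reachable F \<Longrightarrow> (y, z) \<in> graph_reachable F \<Longrightarrow> (x, z) \<in> graph_reachable F"
  by (auto simp: graph_reachable_def)

lemma reach_edge: "{x, y} \<in> F \<Longrightarrow> (x, y) \<in> graph_reachable F"
  by (auto simp: graph_reachable_def)

lemma reach_mono: "F \<subseteq> G \<Longrightarrow> (x, y) \<in> graph_reachable F \<Longrightarrow> (x, y) \<in> graph_reachable G"
  unfolding graph_reachable_def by (rule rtrancl_mono[THEN subsetD, rotated]) auto

definition component :: "'v set set \<Rightarrow> 'v \<Rightarrow> 'v set" where
  "component F x = graph_reachable F `` {x}"

lemma mem_component_iff: "y \<in> component F x \<longleftrightarrow> (x, y) \<in> graph_reachable F"
  by (simp add: component_def)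

lemma equiv_reach: "equiv UNIV (graph_reachable F)"
  by (rule equivI) (auto simp: refl_on_def sym_def trans_def intro: reach_sym reach_trans)

lemma component_eq_iff: "component F x = component F y \<longleftrightarrow> (x, y) \<in> graph_reachable F"
  using eq_equiv_class_iff[OF equiv_reach, of x y] by (simp add: component_def)

lemma graph_components_eq: "graph_components F = range (component F)"
  by (auto simp: graph_components_def quotient_def component_def)

text \<open>
  A walk using the new edge can be shortened to one that uses it once, in one of its two directions.
\<close>

lemma reach_insert_edge:
  "(x, y) \<in> graph_reachable (insert {a, b} F) \<longleftrightarrow>
     (x, y) \<in> graph_reachable F \<or>
     (x, a) \<in> graph_reachable F \<and> (b, y) \<in> graph_reachable F \<or>
     (x, b) \<in> graph_reachable F \<and> (a, y) \<in> graph_reachable F" (is "?l \<longleftrightarrow> ?r")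
proof
  assume ?l
  then have "(x, y) \<in> {(x, y). {x, y} \<in> insert {a, b} F}\<^sup>*" by (simp add: graph_reachable_def)
  then show ?r
  proof (induction rule: rtrancl_induct)
    case (step y z)
    then have "{y, z} = {a, b} \<or> (y, z) \<in> graph_reachable F"
      using reach_edge by fastforce
    moreover have "y = a \<and> z = b \<or> y = b \<and> z = a" if "{y, z} = {a, b}"
      using that by (auto simp: doubleton_eq_iff)
    ultimately show ?case using step.IH by (metis reach_refl reach_sym reach_trans)
  qed simp
next
  have sub: "F \<subseteq> insert {a, b} F" by auto
  have "(a, b) \<in> graph_reachable (insert {a, b} F)" by (simp add: reach_edge)
  then show "?r \<Longrightarrow> ?l" using reach_mono[OF sub] by (meson reach_sym reach_trans)
qed

lemma two_components_iff:
  "card (graph_components F) = 2 \<longleftrightarrow>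
     (\<exists>a b. (a, b) \<notin> graph_reachable F \<and>
       (\<forall>x. (a, x) \<in> graph_reachable F \<or> (b, x) \<in> graph_reachable F))" (is "?l \<longleftrightarrow> ?r")
proof
  assume ?l
  then obtain S T where ST: "graph_components F = {S, T}" "S \<noteq> T" unfolding card_2_iff by blast
  then have "S \<in> range (component F)" "T \<in> range (component F)"
    unfolding graph_components_eq by blast+
  then obtain a b where ab: "S = component F a" "T = component F b" by blast
  have "component F a = component F x \<or> component F b = component F x" for x
  proof -
    have "component F x \<in> graph_components F" unfolding graph_components_eq by (rule rangeI)
    then show ?thesis using ST(1) ab by auto
  qed
  then have "\<forall>x. (a, x) \<in> graph_reachable F \<or> (b, x) \<in> graph_reachable F"
    unfolding component_eq_iff by blast
  moreover have "(a, b) \<notin> graph_reachable F" using ST(2) unfolding ab component_eq_iff .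
  ultimately show ?r by blast
next
  assume ?r
  then obtain a b where ab: "(a, b) \<notin> graph_reachable F"
    "\<And>x. (a, x) \<in> graph_reachable F \<or> (b, x) \<in> graph_reachable F" by auto
  have "component F a = component F x \<or> component F b = component F x" for x
    unfolding component_eq_iff by (rule ab(2))
  then have "graph_components F = {component F a, component F b}"
    unfolding graph_components_eq by blast
  moreover have "component F a \<noteq> component F b" using ab(1) by (simp add: component_eq_iff)
  ultimately show ?l by simp
qed

text \<open>
  Pigeonhole: \<open>u\<close> and \<open>v\<close> already represent both components.
\<close>

lemma two_components_reach:
  assumes "card (graph_components F) = 2" "(u, v) \<notin> graph_reachable F"
  shows "(x, u) \<in> graph_reachable F \<longleftrightarrow> (x, v) \<notin> graph_reachable F"
proof -
  obtain a b where "(a, x) \<in> graph_reachable F \<or> (b, x) \<in> graph_reachable F"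
    "(a, u) \<in> graph_reachable F \<or> (b, u) \<in> graph_reachable F"
    "(a, v) \<in> graph_reachable F \<or> (b, v) \<in> graph_reachable F"
    using assms(1) unfolding two_components_iff by blast
  then show ?thesis using assms(2) by (meson reach_sym reach_trans)
qed

section \<open>Acyclic graphs\<close>

text \<open>
  When a path is extended by a vertex it already visits, it is cut back to that vertex.
\<close>

lemma reach_distinct_path:
  assumes "(x, y) \<in> graph_reachable F"
  shows "\<exists>p. p \<noteq> [] \<and> distinct p \<and> hd p = x \<and> last p = y \<and> successively (\<lambda>a b. {a, b} \<in> F) p"
  using assms unfolding graph_reachable_def
proof (induction rule: rtrancl_induct)
  case base
  show ?case by (rule exI[of _ "[x]"]) simp
next
  case (step y z)
  then obtain p where p: "p \<noteq> []" "distinct p" "hd p = x" "last p = y"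
    "successively (\<lambda>a b. {a, b} \<in> F) p" by auto
  show ?case
  proof (cases "z \<in> set p")
    case True
    then obtain as bs where eq: "p = as @ z # bs" by (meson split_list)
    have "successively (\<lambda>a b. {a, b} \<in> F) (as @ [z])"
      using p(5) unfolding eq by (auto simp: successively_append_iff)
    then show ?thesis using p eq by (intro exI[of _ "as @ [z]"]) (auto simp: hd_append)
  next
    case False
    then show ?thesis using p step.hyps(2)
      by (intro exI[of _ "p @ [z]"]) (auto simp: successively_append_iff)
  qed
qed

text \<open>
  Cycles given as lists are awkward under insertion and deletion of edges. An edge lies on a cycle
  exactly when its ends stay connected without it, so acyclicity becomes a statement about
  reachability alone, which \<open>reach_insert_edge\<close> can handle.
\<close>

lemma acyclic_graph_iff_bridges:
  assumes "simple_graph F"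
  shows "acyclic_graph F \<longleftrightarrow>
    (\<forall>u x. {u, x} \<in> F \<longrightarrow> (u, x) \<notin> graph_reachable (F - {{u, x}}))" (is "_ \<longleftrightarrow> ?r")
proof (intro iffI allI impI notI)
  fix u x assume ac: "acyclic_graph F" and e: "{u, x} \<in> F"
    and "(u, x) \<in> graph_reachable (F - {{u, x}})"
  then obtain p where p: "p \<noteq> []" "distinct p" "hd p = u" "last p = x"
    "successively (\<lambda>a b. {a, b} \<in> F - {{u, x}}) p" using reach_distinct_path by metis
  have "u \<noteq> x" using e assms by (auto simp: simple_graph_def)
  have edges: "{p ! i, p ! Suc i} \<in> F - {{u, x}}" if "Suc i < length p" for i
    using p(5) that unfolding successively_conv_nth by auto
  have h: "p ! 0 = u" "p ! (length p - 1) = x"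
    using p by (auto simp: hd_conv_nth last_conv_nth)
  have "length p \<noteq> 1" using h \<open>u \<noteq> x\<close> by auto
  moreover have "length p \<noteq> 2" using h edges[of 0] by auto
  ultimately have len: "length p \<ge> 3" using p(1) by (cases "length p") auto
  have "{p ! i, p ! ((i + 1) mod length p)} \<in> F" if "i < length p" for i
  proof (cases "Suc i < length p")
    case True
    then show ?thesis using edges[of i] by simp
  next
    case False
    then have "Suc i = length p" using that by linarith
    then have "(i + 1) mod length p = 0" "i = length p - 1" by simp_all
    then show ?thesis using h e by (simp add: insert_commute)
  qed
  then have "graph_cycle F p" using len p(2) by (simp add: graph_cycle_def)
  then show False using ac by (auto simp: acyclic_graph_def)
next
  assume r: ?r
  show "acyclic_graph F" unfolding acyclic_graph_def
  proof
    assume "\<exists>p. graph_cycle F p"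
    then obtain p where len: "length p \<ge> 3" and d: "distinct p"
      and edges: "\<And>i. i < length p \<Longrightarrow> {p ! i, p ! ((i + 1) mod length p)} \<in> F"
      by (auto simp: graph_cycle_def)
    define n where "n = length p"
    \<comment> \<open>The closing edge of the cycle: the others form a path between its ends, and they differ
      from it because a cycle has at least three vertices.\<close>
    let ?e = "{p ! 0, p ! (n - 1)}"
    have "Suc (n - 1) = length p" using len by (simp add: n_def)
    then have "?e \<in> F" using edges[of "n - 1"] len by (simp add: n_def insert_commute)
    moreover have "(p ! 0, p ! i) \<in> graph_reachable (F - {?e})" if "i < n" for i
      using that
    proof (induction i)
      case (Suc i)
      have "{p ! i, p ! Suc i} \<in> F" using edges[of i] Suc.prems by (simp add: n_def)
      moreover have "{p ! i, p ! Suc i} \<noteq> ?e"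
      proof -
        have "p ! i = p ! 0 \<longleftrightarrow> i = 0" "p ! Suc i \<noteq> p ! 0" "p ! Suc i = p ! (n - 1) \<longleftrightarrow> Suc i = n - 1"
          using nth_eq_iff_index_eq[OF d, of i 0] nth_eq_iff_index_eq[OF d, of "Suc i" 0]
            nth_eq_iff_index_eq[OF d, of "Suc i" "n - 1"] len Suc.prems unfolding n_def by linarith+
        then show ?thesis using len unfolding doubleton_eq_iff n_def by linarith
      qed
      ultimately have "(p ! i, p ! Suc i) \<in> graph_reachable (F - {?e})"
        by (intro reach_edge) auto
      then show ?case using Suc by (auto intro: reach_trans)
    qed simp
    moreover have "n - 1 < n" using len by (simp add: n_def)
    ultimately show False using r by blast
  qed
qed

lemma simple_graph_subset: "simple_graph E \<Longrightarrow> F \<subseteq> E \<Longrightarrow> simple_graph F"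
  by (auto simp: simple_graph_def)

lemma acyclic_graph_subset: "acyclic_graph F \<Longrightarrow> G \<subseteq> F \<Longrightarrow> acyclic_graph G"
  unfolding acyclic_graph_def graph_cycle_def by blast

text \<open>
  If an old edge \<open>cd\<close> stopped being a bridge, the detour around it would use \<open>ab\<close>; then the rest of
  the detour together with \<open>cd\<close> would already connect \<open>a\<close> to \<open>b\<close> in \<open>F\<close>.
\<close>

lemma acyclic_graph_insert:
  assumes "simple_graph (insert {a, b} F)" "acyclic_graph F" "(a, b) \<notin> graph_reachable F"
  shows "acyclic_graph (insert {a, b} F)"
proof -
  have sF: "simple_graph F" using assms(1) by (auto simp: simple_graph_def)
  have ab: "{a, b} \<notin> F" using assms(3) reach_edge by metis
  have "(c, d) \<notin> graph_reachable (insert {a, b} F - {{c, d}})"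
    if cd: "{c, d} \<in> insert {a, b} F" for c d
  proof (cases "{c, d} = {a, b}")
    case True
    then have "insert {a, b} F - {{c, d}} = F" using ab by auto
    moreover have "c = a \<and> d = b \<or> c = b \<and> d = a" using True by (simp add: doubleton_eq_iff)
    ultimately show ?thesis using assms(3) reach_sym by metis
  next
    case False
    then have cdF: "{c, d} \<in> F" using cd by auto
    have eq: "insert {a, b} F - {{c, d}} = insert {a, b} (F - {{c, d}})" using False by auto
    have sub: "F - {{c, d}} \<subseteq> F" by auto
    have "(c, d) \<notin> graph_reachable (F - {{c, d}})"
      using assms(2) cdF acyclic_graph_iff_bridges[OF sF] by auto
    moreover have "(c, d) \<in> graph_reachable F" using cdF by (rule reach_edge)
    ultimately show ?thesis
      unfolding eq reach_insert_edge using assms(3) reach_mono[OF sub]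
      by (meson reach_sym reach_trans)
  qed
  then show ?thesis unfolding acyclic_graph_iff_bridges[OF assms(1)] by blast
qed

section \<open>Trees\<close>

lemma connected_graph_delete_edge:
  assumes "connected_graph F" "(u, x) \<in> graph_reachable (F - {{u, x}})"
  shows "connected_graph (F - {{u, x}})"
proof -
  have "(a, b) \<in> graph_reachable (F - {{u, x}})" for a b
  proof -
    have "(a, b) \<in> graph_reachable (insert {u, x} (F - {{u, x}}))"
      using assms(1) reach_mono[of F "insert {u, x} (F - {{u, x}})"]
      by (auto simp: connected_graph_def)
    then show ?thesis unfolding reach_insert_edge using assms(2) by (meson reach_sym reach_trans)
  qed
  then show ?thesis by (simp add: connected_graph_def)
qed

text \<open>
  A connected subgraph with the fewest edges is a tree, since an edge that is not a bridge could be removed.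
\<close>

lemma spanning_trees_nonempty:
  fixes E :: "('v::finite) set set"
  assumes "simple_graph E" "connected_graph E"
  shows "spanning_trees E \<noteq> {}"
proof -
  obtain F where F: "F \<subseteq> E" "connected_graph F"
    and min: "\<And>G. G \<subseteq> E \<Longrightarrow> connected_graph G \<Longrightarrow> card F \<le> card G"
    using ex_has_least_nat[of "\<lambda>F. F \<subseteq> E \<and> connected_graph F" E card] assms(2) by auto
  have "(u, x) \<notin> graph_reachable (F - {{u, x}})" if "{u, x} \<in> F" for u x
  proof
    assume "(u, x) \<in> graph_reachable (F - {{u, x}})"
    then have "connected_graph (F - {{u, x}})" by (rule connected_graph_delete_edge[OF F(2)])
    then have "card F \<le> card (F - {{u, x}})" using F(1) by (intro min) auto
    moreover have "card (F - {{u, x}}) < card F" using that by (intro psubset_card_mono) auto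
    ultimately show False by simp
  qed
  then have "acyclic_graph F"
    using acyclic_graph_iff_bridges[OF simple_graph_subset[OF assms(1) F(1)]] by auto
  then show ?thesis using F by (auto simp: spanning_trees_def)
qed

text \<open>
  Following a walk from \<open>u\<close> to \<open>w\<close> from its last visit to \<open>u\<close> on gives the first edge of a path to \<open>w\<close>,
  while the remainder avoids \<open>u\<close>. This replaces the choice of a simple path.
\<close>

lemma reach_last_exit:
  assumes "(u, w) \<in> graph_reachable F" "w \<noteq> u"
  shows "\<exists>x. {u, x} \<in> F \<and> (x, w) \<in> graph_reachable {e \<in> F. u \<notin> e}"
  using assms unfolding graph_reachable_def
proof (induction rule: rtrancl_induct)
  case (step y z)
  show ?case
  proof (cases "y = u")
    case True
    then show ?thesis using step.hyps by auto
  next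
    case False
    then have "(y, z) \<in> {(x, y). {x, y} \<in> {e \<in> F. u \<notin> e}}" using step by auto
    then show ?thesis using step.IH[OF False] by (meson rtrancl.rtrancl_into_rtrancl)
  qed
qed simp

text \<open>
  The edge at \<open>u\<close> whose removal separates \<open>u\<close> from \<open>w\<close> is the first edge of the tree path from \<open>u\<close> to \<open>w\<close>.
  Removing it separates, as it is a bridge; removing any other edge at \<open>u\<close> leaves the path intact.
\<close>

lemma card_separating_edges:
  fixes T :: "('v::finite) set set"
  assumes "simple_graph T" "acyclic_graph T" "connected_graph T"
  shows "card {x. {u, x} \<in> T \<and> (w, u) \<notin> graph_reachable (T - {{u, x}})} = of_bool (w \<noteq> u)"
    
proof (cases "w = u")
  case False
  obtain x where x: "{u, x} \<in> T" "(x, w) \<in> graph_reachable {e \<in> T. u \<notin> e}"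
    using reach_last_exit[of u w T] False assms(3) by (auto simp: connected_graph_def)
  have xw: "(x, w) \<in> graph_reachable (T - {{u, y}})" for y
    by (rule reach_mono[OF _ x(2)]) auto
  have "(u, x) \<notin> graph_reachable (T - {{u, x}})"
    using acyclic_graph_iff_bridges[OF assms(1)] assms(2) x(1) by auto
  then have "(w, u) \<notin> graph_reachable (T - {{u, x}})"
    using xw[of x] by (meson reach_sym reach_trans)
  moreover have "y = x" if "(w, u) \<notin> graph_reachable (T - {{u, y}})" for y
  proof (rule ccontr)
    assume "y \<noteq> x"
    then have "{u, x} \<in> T - {{u, y}}" using x(1) by (auto simp: doubleton_eq_iff)
    then have "(u, w) \<in> graph_reachable (T - {{u, y}})"
      by (rule reach_trans[OF reach_edge xw])
    then show False using that reach_sym[of u w] by blast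
  qed
  ultimately have "{y. {u, y} \<in> T \<and> (w, u) \<notin> graph_reachable (T - {{u, y}})} = {x}"
    using x(1) by blast
  then show ?thesis using False by simp
qed simp

lemma bij_delete_edge:
  fixes E :: "('v::finite) set set"
  assumes E: "simple_graph E" and e: "{u, x} \<in> E"
  shows "bij_betw (\<lambda>T. T - {{u, x}}) {T \<in> spanning_trees E. {u, x} \<in> T}
           {F \<in> spanning_2forests E. (u, x) \<notin> graph_reachable F}"
proof (rule bij_betw_byWitness[where f' = "insert {u, x}"])
  show "\<forall>T\<in>{T \<in> spanning_trees E. {u, x} \<in> T}. insert {u, x} (T - {{u, x}}) = T" by auto
  show "\<forall>F\<in>{F \<in> spanning_2forests E. (u, x) \<notin> graph_reachable F}. insert {u, x} F - {{u, x}} = F"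
    by (auto dest: reach_edge)
  show "(\<lambda>T. T - {{u, x}}) ` {T \<in> spanning_trees E. {u, x} \<in> T}
      \<subseteq> {F \<in> spanning_2forests E. (u, x) \<notin> graph_reachable F}"
  proof (rule image_subsetI)
    fix T assume "T \<in> {T \<in> spanning_trees E. {u, x} \<in> T}"
    then have T: "T \<subseteq> E" "acyclic_graph T" "connected_graph T" "{u, x} \<in> T"
      by (auto simp: spanning_trees_def)
    let ?F = "T - {{u, x}}"
    have ux: "(u, x) \<notin> graph_reachable ?F"
      using T acyclic_graph_iff_bridges[OF simple_graph_subset[OF E T(1)]] by auto
    have "(u, y) \<in> graph_reachable ?F \<or> (x, y) \<in> graph_reachable ?F" for y
    proof -
      have "(u, y) \<in> graph_reachable (insert {u, x} ?F)"
        using T(3,4) by (auto simp: connected_graph_def insert_absorb)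
      then show ?thesis unfolding reach_insert_edge by auto
    qed
    then have "card (graph_components ?F) = 2" using ux by (auto simp: two_components_iff)
    moreover have "acyclic_graph ?F" using T(2) by (rule acyclic_graph_subset) auto
    ultimately show "?F \<in> {F \<in> spanning_2forests E. (u, x) \<notin> graph_reachable F}"
      using ux T(1) by (auto simp: spanning_2forests_def)
  qed
  show "insert {u, x} ` {F \<in> spanning_2forests E. (u, x) \<notin> graph_reachable F}
      \<subseteq> {T \<in> spanning_trees E. {u, x} \<in> T}"
  proof (rule image_subsetI)
    fix F assume "F \<in> {F \<in> spanning_2forests E. (u, x) \<notin> graph_reachable F}"
    then have F: "F \<subseteq> E" "acyclic_graph F" "card (graph_components F) = 2"
      and ux: "(u, x) \<notin> graph_reachable F" by (auto simp: spanning_2forests_def)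
    let ?T = "insert {u, x} F"
    have sub: "?T \<subseteq> E" using F(1) e by auto
    have "acyclic_graph ?T"
      by (rule acyclic_graph_insert[OF simple_graph_subset[OF E sub] F(2) ux])
    moreover have "connected_graph ?T"
      unfolding connected_graph_def reach_insert_edge
      using two_components_reach[OF F(3) ux] by (meson reach_sym reach_trans)
    ultimately show "?T \<in> {T \<in> spanning_trees E. {u, x} \<in> T}"
      using sub by (auto simp: spanning_trees_def)
  qed
qed

section \<open>Kirchhoff's current law for spanning 2-forests\<close>

text \<open>
  A forest with \<open>u\<close> and \<open>x\<close> in the same component contributes \<open>0\<close>. In any other, \<open>u\<close> and \<open>x\<close> represent
  the two components, so the contribution depends only on whether \<open>v\<close> and \<open>w\<close> lie on the side of \<open>u\<close>:
  it is \<open>1\<close> if only \<open>w\<close> does, \<open>- 1\<close> if only \<open>v\<close> does, and \<open>0\<close> otherwise.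
\<close>

lemma forest_sum_over_edge:
  fixes E :: "('v::finite) set set"
  assumes E: "simple_graph E" and e: "{u, x} \<in> E"
  shows "(\<Sum>F\<in>spanning_2forests E. of_bool ((w, v) \<notin> graph_reachable F) *
             (of_bool ((u, v) \<notin> graph_reachable F) - of_bool ((x, v) \<notin> graph_reachable F)) :: real)
       = (\<Sum>T | T \<in> spanning_trees E \<and> {u, x} \<in> T.
             of_bool ((v, u) \<notin> graph_reachable (T - {{u, x}}))
           - of_bool ((w, u) \<notin> graph_reachable (T - {{u, x}})))"
proof -
  let ?g = "\<lambda>F. of_bool ((w, v) \<notin> graph_reachable F) *
             (of_bool ((u, v) \<notin> graph_reachable F) - of_bool ((x, v) \<notin> graph_reachable F)) :: real"
  let ?S = "{F \<in> spanning_2forests E. (u, x) \<notin> graph_reachable F}"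
  have "?g F = 0" if "(u, x) \<in> graph_reachable F" for F
  proof -
    have "(u, v) \<in> graph_reachable F \<longleftrightarrow> (x, v) \<in> graph_reachable F"
      using that by (meson reach_sym reach_trans)
    then show ?thesis by simp
  qed
  then have "sum ?g (spanning_2forests E) = sum ?g ?S"
    by (intro sum.mono_neutral_right) auto
  also have "\<dots> = (\<Sum>F\<in>?S. of_bool ((v, u) \<notin> graph_reachable F) - of_bool ((w, u) \<notin> graph_reachable F))"
  proof (rule sum.cong)
    fix F assume "F \<in> ?S"
    then have c: "card (graph_components F) = 2" and ux: "(u, x) \<notin> graph_reachable F"
      by (auto simp: spanning_2forests_def)
    have "(x, v) \<in> graph_reachable F \<longleftrightarrow> (u, v) \<notin> graph_reachable F"
      using two_components_reach[OF c ux, of v] by (simp add: reach_commute)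
    moreover have "(w, v) \<in> graph_reachable F \<longleftrightarrow>
      ((w, u) \<in> graph_reachable F \<longleftrightarrow> (v, u) \<in> graph_reachable F)"
      using two_components_reach[OF c ux, of w] two_components_reach[OF c ux, of v]
      by (meson reach_sym reach_trans)
    moreover have "(u, v) \<in> graph_reachable F \<longleftrightarrow> (v, u) \<in> graph_reachable F"
      by (rule reach_commute)
    ultimately show "?g F = of_bool ((v, u) \<notin> graph_reachable F) - of_bool ((w, u) \<notin> graph_reachable F)"
      by auto
  qed simp
  also have "\<dots> = (\<Sum>T | T \<in> spanning_trees E \<and> {u, x} \<in> T.
             of_bool ((v, u) \<notin> graph_reachable (T - {{u, x}}))
           - of_bool ((w, u) \<notin> graph_reachable (T - {{u, x}})))"
    by (rule sum.reindex_bij_betw[OF bij_delete_edge[OF E e], symmetric])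
  finally show ?thesis .
qed

text \<open>
  Summed over the edges of a fixed tree at \<open>u\<close>, each of the two terms from \<open>forest_sum_over_edge\<close>
  counts the edges separating \<open>u\<close> from a given vertex; there is one such edge unless that vertex is
  \<open>u\<close> itself.
\<close>

lemma forest_current_law:
  fixes E :: "('v::finite) set set"
  assumes E: "simple_graph E"
  shows "(\<Sum>x | {u, x} \<in> E. \<Sum>F\<in>spanning_2forests E. of_bool ((w, v) \<notin> graph_reachable F) *
             (of_bool ((u, v) \<notin> graph_reachable F) - of_bool ((x, v) \<notin> graph_reachable F)) :: real)
       = real (card (spanning_trees E)) * (of_bool (w = u) - of_bool (v = u))"
proof -
  let ?s = "\<lambda>T w x. of_bool ((w, u) \<notin> graph_reachable (T - {{u, x}})) :: real"
  have tree: "(\<Sum>x | {u, x} \<in> T. ?s T w x) = of_bool (w \<noteq> u)" if "T \<in> spanning_trees E" for T w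
  proof -
    have T: "simple_graph T" "acyclic_graph T" "connected_graph T"
      using that simple_graph_subset[OF E] by (auto simp: spanning_trees_def)
    have "(\<Sum>x | {u, x} \<in> T. ?s T w x)
        = real (card {x. {u, x} \<in> T \<and> (w, u) \<notin> graph_reachable (T - {{u, x}})})"
      by (simp add: sum_of_bool_eq Int_def)
    then show ?thesis by (simp add: card_separating_edges[OF T])
  qed
  have "(\<Sum>x | {u, x} \<in> E. \<Sum>F\<in>spanning_2forests E. of_bool ((w, v) \<notin> graph_reachable F) *
             (of_bool ((u, v) \<notin> graph_reachable F) - of_bool ((x, v) \<notin> graph_reachable F)) :: real)
      = (\<Sum>x | {u, x} \<in> E. \<Sum>T | T \<in> spanning_trees E \<and> {u, x} \<in> T. ?s T v x - ?s T w x)"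
    by (intro sum.cong refl forest_sum_over_edge[OF E]) simp
  also have "\<dots> = (\<Sum>T\<in>spanning_trees E. \<Sum>x | x \<in> {x. {u, x} \<in> E} \<and> {u, x} \<in> T. ?s T v x - ?s T w x)"
    by (rule sum.swap_restrict) auto
  also have "\<dots> = (\<Sum>T\<in>spanning_trees E. \<Sum>x | {u, x} \<in> T. ?s T v x - ?s T w x)"
    by (intro sum.cong) (auto simp: spanning_trees_def)
  also have "\<dots> = (\<Sum>T\<in>spanning_trees E. of_bool (w = u) - of_bool (v = u))"
    by (intro sum.cong refl) (simp only: sum_subtractf tree, simp)
  finally show ?thesis by simp
qed


section \<open>The forest kernel\<close>

text \<open>
  The difference of the two sums over named forests, as a single sum over forests. The component
  of \<open>v\<close> is used to name the two parts, which makes the Laplacian in the first argument easy to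
  compute but hides the symmetry in \<open>u\<close> and \<open>v\<close>.
\<close>

definition forest_kernel :: "('v::finite) set set \<Rightarrow> 'v \<Rightarrow> 'v \<Rightarrow> real" where
  "forest_kernel E u v = (\<Sum>F\<in>spanning_2forests E.
     if (u, v) \<in> graph_reachable F then (real (vol E (- component F v)))\<^sup>2
     else - (real (vol E (component F v)) * real (vol E (- component F v))))"

lemma components_2forest:
  assumes "card (graph_components F) = 2"
  shows "graph_components F = {component F v, - component F v}"
proof -
  obtain b where vb: "(v, b) \<notin> graph_reachable F"
    using assms unfolding two_components_iff by (meson reach_sym reach_trans)
  have "component F b = - component F v"
  proof (rule set_eqI)
    fix x
    show "x \<in> component F b \<longleftrightarrow> x \<in> - component F v"
      using two_components_reach[OF assms vb, of x] unfolding Compl_iff mem_component_iff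
      by (meson reach_sym)
  qed
  moreover have "component F x = component F v \<or> component F x = component F b" for x
    using two_components_reach[OF assms vb, of x] unfolding component_eq_iff by blast
  ultimately show ?thesis unfolding graph_components_eq by blast
qed

text \<open>
  Knowing that a vertex lies in the first component determines the naming.
\<close>

lemma named_2forests_iff:
  assumes "v \<in> T\<^sub>1"
  shows "(F, T\<^sub>1, T\<^sub>2) \<in> named_2forests E \<longleftrightarrow>
    F \<in> spanning_2forests E \<and> T\<^sub>1 = component F v \<and> T\<^sub>2 = - component F v"
proof (cases "F \<in> spanning_2forests E")
  case True
  then have eq: "graph_components F = {component F v, - component F v}"
    by (intro components_2forest) (simp add: spanning_2forests_def)
  have "v \<in> component F v" by (simp add: mem_component_iff)
  then have "{component F v, - component F v} = {T\<^sub>1, T\<^sub>2} \<longleftrightarrow>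
      T\<^sub>1 = component F v \<and> T\<^sub>2 = - component F v"
    using assms unfolding doubleton_eq_iff by auto
  then show ?thesis using True by (simp add: named_2forests_def eq)
qed (simp add: named_2forests_def)

lemma named_2forests_iff_snd:
  assumes "v \<in> T\<^sub>2"
  shows "(F, T\<^sub>1, T\<^sub>2) \<in> named_2forests E \<longleftrightarrow>
    F \<in> spanning_2forests E \<and> T\<^sub>2 = component F v \<and> T\<^sub>1 = - component F v"
  using named_2forests_iff[OF assms, of F T\<^sub>1 E]
  by (simp add: named_2forests_def insert_commute)

lemma forest_kernel_eq_named_sums:
  fixes E :: "('v::finite) set set"
  shows "(\<Sum>(F, T\<^sub>1, T\<^sub>2) \<in> {(F, T\<^sub>1, T\<^sub>2) \<in> named_2forests E. u \<in> T\<^sub>1 \<and> v \<in> T\<^sub>1}. (real (vol E T\<^sub>2))\<^sup>2)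
     - (\<Sum>(F, T\<^sub>1, T\<^sub>2) \<in> {(F, T\<^sub>1, T\<^sub>2) \<in> named_2forests E. u \<in> T\<^sub>1 \<and> v \<in> T\<^sub>2}. real (vol E T\<^sub>1) * real (vol E T\<^sub>2))
     = forest_kernel E u v" (is "?same - ?diff = _")
proof -
  let ?C = "\<lambda>F. component F v"
  let ?near = "{F \<in> spanning_2forests E. (u, v) \<in> graph_reachable F}"
  let ?far = "{F \<in> spanning_2forests E. (u, v) \<notin> graph_reachable F}"
  have mem: "u \<in> ?C F \<longleftrightarrow> (u, v) \<in> graph_reachable F" for F
    unfolding mem_component_iff by (rule reach_commute)
  have self: "v \<in> ?C F" for F by (simp add: mem_component_iff)
  have "{(F, T\<^sub>1, T\<^sub>2) \<in> named_2forests E. u \<in> T\<^sub>1 \<and> v \<in> T\<^sub>1} = (\<lambda>F. (F, ?C F, - ?C F)) ` ?near"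
  proof (rule set_eqI)
    fix p :: "'v set set \<times> 'v set \<times> 'v set"
    obtain F T\<^sub>1 T\<^sub>2 where p: "p = (F, T\<^sub>1, T\<^sub>2)" by (cases p)
    show "p \<in> {(F, T\<^sub>1, T\<^sub>2) \<in> named_2forests E. u \<in> T\<^sub>1 \<and> v \<in> T\<^sub>1} \<longleftrightarrow> p \<in> (\<lambda>F. (F, ?C F, - ?C F)) ` ?near"
      using named_2forests_iff[of v T\<^sub>1 F T\<^sub>2 E] mem[of F] self[of F] unfolding p by auto
  qed
  then have 1: "?same = (\<Sum>F\<in>?near. (real (vol E (- ?C F)))\<^sup>2)"
    by (simp add: sum.reindex inj_on_def)
  have "{(F, T\<^sub>1, T\<^sub>2) \<in> named_2forests E. u \<in> T\<^sub>1 \<and> v \<in> T\<^sub>2} = (\<lambda>F. (F, - ?C F, ?C F)) ` ?far"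
  proof (rule set_eqI)
    fix p :: "'v set set \<times> 'v set \<times> 'v set"
    obtain F T\<^sub>1 T\<^sub>2 where p: "p = (F, T\<^sub>1, T\<^sub>2)" by (cases p)
    show "p \<in> {(F, T\<^sub>1, T\<^sub>2) \<in> named_2forests E. u \<in> T\<^sub>1 \<and> v \<in> T\<^sub>2} \<longleftrightarrow> p \<in> (\<lambda>F. (F, - ?C F, ?C F)) ` ?far"
      using named_2forests_iff_snd[of v T\<^sub>2 F T\<^sub>1 E] mem[of F] self[of F] unfolding p by auto
  qed
  then have 2: "?diff = (\<Sum>F\<in>?far. real (vol E (?C F)) * real (vol E (- ?C F)))"
    by (simp add: sum.reindex inj_on_def mult.commute)
  show ?thesis
    unfolding 1 2 forest_kernel_def
    by (simp add: sum.If_cases Int_def sum_negf)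
qed

lemma vol_compl: "vol E U + vol E (- U) = vol E (UNIV :: 'v::finite set)"
  unfolding vol_def by (subst sum.union_disjoint[symmetric]) auto

lemma forest_kernel_commute: "forest_kernel E u v = forest_kernel E v u"
  unfolding forest_kernel_def
proof (rule sum.cong)
  fix F assume "F \<in> spanning_2forests E"
  then have c: "card (graph_components F) = 2" by (simp add: spanning_2forests_def)
  show "(if (u, v) \<in> graph_reachable F then (real (vol E (- component F v)))\<^sup>2
       else - (real (vol E (component F v)) * real (vol E (- component F v)))) =
      (if (v, u) \<in> graph_reachable F then (real (vol E (- component F u)))\<^sup>2
       else - (real (vol E (component F u)) * real (vol E (- component F u))))"
  proof (cases "(u, v) \<in> graph_reachable F")
    case True
    then show ?thesis using reach_sym[OF True] component_eq_iff[of F u v] by simp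
  next
    case False
    have "component F u \<in> graph_components F" unfolding graph_components_eq by (rule rangeI)
    moreover have "component F u \<noteq> component F v" using False by (simp add: component_eq_iff)
    ultimately have "component F u = - component F v" using components_2forest[OF c, of v] by auto
    then show ?thesis using False reach_sym[of v u F] by auto
  qed
qed simp

text \<open>
  For each forest, with \<open>C\<close> the component of \<open>v\<close> and \<open>C'\<close> the other one, the weighted sum is
  \<open>vol(C) vol(C')\<^sup>2 - vol(C') vol(C) vol(C') = 0\<close>.
\<close>

lemma forest_kernel_degree_orthogonal:
  fixes E :: "('v::finite) set set"
  shows "(\<Sum>u\<in>UNIV. real (vertex_degree E u) * forest_kernel E u v) = 0"
proof -
  let ?d = "\<lambda>u. real (vertex_degree E u)"
  have "(\<Sum>u\<in>UNIV. ?d u * (if (u, v) \<in> graph_reachable F then b else c)) =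
      real (vol E (component F v)) * b + real (vol E (- component F v)) * c" for F and b c :: real
  proof -
    have "{u. (u, v) \<in> graph_reachable F} = component F v"
      by (auto simp: mem_component_iff intro: reach_sym)
    moreover from this have "{u. (u, v) \<notin> graph_reachable F} = - component F v" by auto
    ultimately show ?thesis
      by (simp add: if_distrib[of "(*) _"] sum.If_cases vol_def sum_distrib_right Collect_neg_eq[symmetric]
          cong: if_cong)
  qed
  then have "(\<Sum>F\<in>spanning_2forests E. \<Sum>u\<in>UNIV. ?d u *
     (if (u, v) \<in> graph_reachable F then (real (vol E (- component F v)))\<^sup>2
     else - (real (vol E (component F v)) * real (vol E (- component F v))))) = 0"
    by (simp add: power2_eq_square)
  then show ?thesis
    unfolding forest_kernel_def sum_distrib_left by (subst sum.swap)
qed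

text \<open>
  Up to a term independent of \<open>u\<close>, a forest contributes \<open>- vol(\<Gamma>) vol(C') [u \<in> C']\<close> to the kernel, where
  \<open>C'\<close> is the component avoiding \<open>v\<close>. Expanding \<open>vol(C')\<close> over its vertices \<open>w\<close> leaves the sum of
  \<open>forest_current_law\<close>, weighted by \<open>d\<^sub>w\<close>.
\<close>

lemma forest_kernel_laplacian:
  fixes E :: "('v::finite) set set"
  assumes E: "simple_graph E"
  shows "(\<Sum>x | {u, x} \<in> E. forest_kernel E u v - forest_kernel E x v) =
    real (vol E UNIV) * real (card (spanning_trees E)) *
      (real (vol E UNIV) * of_bool (u = v) - real (vertex_degree E u))"
proof -
  let ?V = "real (vol E UNIV)" and ?t = "real (card (spanning_trees E))"
  let ?d = "\<lambda>u. real (vertex_degree E u)"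
  let ?n = "\<lambda>F u. of_bool ((u, v) \<notin> graph_reachable F) :: real"
  have kernel: "forest_kernel E u v = (\<Sum>F\<in>spanning_2forests E. (real (vol E (- component F v)))\<^sup>2
      - ?V * (real (vol E (- component F v)) * ?n F u))" for u
    unfolding forest_kernel_def
  proof (rule sum.cong)
    fix F
    have "?V = real (vol E (component F v)) + real (vol E (- component F v))"
      using vol_compl[of E "component F v"] by simp
    then show "(if (u, v) \<in> graph_reachable F then (real (vol E (- component F v)))\<^sup>2
       else - (real (vol E (component F v)) * real (vol E (- component F v)))) =
      (real (vol E (- component F v)))\<^sup>2 - ?V * (real (vol E (- component F v)) * ?n F u)"
      by (simp add: power2_eq_square algebra_simps)
  qed simp
  have vol: "real (vol E (- component F v)) = (\<Sum>w\<in>UNIV. ?d w * ?n F w)" for F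
  proof -
    have "- component F v = {w. (w, v) \<notin> graph_reachable F}"
      by (auto simp: mem_component_iff intro: reach_sym)
    then show ?thesis by (simp add: vol_def sum.If_cases of_bool_def if_distrib[of "(*) _"] cong: if_cong)
  qed
  have "forest_kernel E u v - forest_kernel E x v =
      - ?V * (\<Sum>w\<in>UNIV. ?d w * (\<Sum>F\<in>spanning_2forests E. ?n F w * (?n F u - ?n F x)))" for x
  proof -
    have "forest_kernel E u v - forest_kernel E x v =
      - ?V * (\<Sum>F\<in>spanning_2forests E. real (vol E (- component F v)) * (?n F u - ?n F x))"
      unfolding kernel sum_subtractf[symmetric] sum_distrib_left
      by (intro sum.cong refl) (simp add: algebra_simps)
    also have "(\<Sum>F\<in>spanning_2forests E. real (vol E (- component F v)) * (?n F u - ?n F x)) =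
      (\<Sum>F\<in>spanning_2forests E. \<Sum>w\<in>UNIV. ?d w * (?n F w * (?n F u - ?n F x)))"
      unfolding vol sum_distrib_right mult.assoc ..
    also have "\<dots> = (\<Sum>w\<in>UNIV. ?d w * (\<Sum>F\<in>spanning_2forests E. ?n F w * (?n F u - ?n F x)))"
      unfolding sum_distrib_left by (rule sum.swap)
    finally show ?thesis .
  qed
  then have "(\<Sum>x | {u, x} \<in> E. forest_kernel E u v - forest_kernel E x v) =
      - ?V * (\<Sum>x | {u, x} \<in> E. \<Sum>w\<in>UNIV. ?d w * (\<Sum>F\<in>spanning_2forests E. ?n F w * (?n F u - ?n F x)))"
    by (simp only: sum_distrib_left)
  also have "\<dots> = - ?V * (\<Sum>w\<in>UNIV. ?d w *
      (\<Sum>x | {u, x} \<in> E. \<Sum>F\<in>spanning_2forests E. ?n F w * (?n F u - ?n F x)))"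
    by (subst sum.swap) (simp only: sum_distrib_left)
  also have "\<dots> = - ?V * (\<Sum>w\<in>UNIV. ?d w * (?t * (of_bool (w = u) - of_bool (v = u))))"
    unfolding forest_current_law[OF E] ..
  also have "(\<Sum>w\<in>UNIV. ?d w * (?t * (of_bool (w = u) - of_bool (v = u)))) =
      ?t * ((\<Sum>w\<in>UNIV. ?d w * of_bool (w = u)) - (\<Sum>w\<in>UNIV. ?d w) * of_bool (v = u))"
    unfolding sum_distrib_left sum_distrib_right sum_subtractf[symmetric]
    by (intro sum.cong refl) (simp add: algebra_simps)
  also have "(\<Sum>w\<in>UNIV. ?d w * of_bool (w = u)) = ?d u"
    by (simp add: of_bool_def if_distrib[of "(*) _"] cong: if_cong)
  also have "(\<Sum>w\<in>UNIV. ?d w) = ?V" by (simp add: vol_def)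
  finally show ?thesis by (simp add: algebra_simps eq_commute)
qed

section \<open>The Moore--Penrose inverse\<close>

lemma matrix_diff_rdistrib: "(A - B) ** C = A ** C - B ** C" for A B C :: "real ^ 'n ^ 'n"
  by (simp add: matrix_matrix_mult_def vec_eq_iff left_diff_distrib sum_subtractf)

text \<open>
  By symmetry \<open>X M = (M X)\<^sup>T\<close> is the same matrix \<open>I - P\<close>, which acts as the identity on \<open>M\<close> and on \<open>X\<close>
  because \<open>P\<close> annihilates both.
\<close>

lemma moore_penrose_eq_of_projection:
  fixes M X P :: "real ^ 'n ^ 'n"
  assumes sym: "transpose M = M" "transpose X = X" "transpose P = P"
    and MX: "M ** X = mat 1 - P" and PM: "P ** M = 0" and PX: "P ** X = 0"
  shows "moore_penrose M = X"
proof -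
  have "transpose (M ** X) = transpose (mat 1 - P)" using MX by simp
  also have "transpose (mat 1 - P) = mat 1 - P"
    using sym(3) by (simp add: transpose_def mat_def vec_eq_iff)
  finally have t: "transpose (M ** X) = mat 1 - P" .
  then have XM: "X ** M = mat 1 - P" by (simp add: matrix_transpose_mul sym)
  have "(mat 1 - P) ** M = M" "(mat 1 - P) ** X = X"
    by (simp_all add: matrix_diff_rdistrib PM PX)
  then have "is_moore_penrose M X"
    using t by (auto simp: is_moore_penrose_def MX XM matrix_transpose_mul sym)
  then show ?thesis
    unfolding moore_penrose_def by (blast intro: the_equality is_moore_penrose_unique)
qed

lemma diag_matrix_conjugate:
  "(diag_matrix f ** M ** diag_matrix g) $ i $ j = f i * M $ i $ j * g j"
  for M :: "real ^ 'n ^ 'n"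
  by (simp add: matrix_matrix_mult_def diag_matrix_def if_distrib[of "\<lambda>x. _ * x"]
      if_distrib[of "\<lambda>x. x * _"] cong: if_cong)

lemma vertex_degree_eq_card_neighbours:
  assumes "simple_graph E"
  shows "vertex_degree E u = card {x. {u, x} \<in> E}"
proof -
  have "{e \<in> E. u \<in> e} = (\<lambda>x. {u, x}) ` {x. {u, x} \<in> E}"
  proof (intro subset_antisym subsetI)
    fix e assume e: "e \<in> {e \<in> E. u \<in> e}"
    then obtain a b where "e = {a, b}" using assms by (auto simp: simple_graph_def card_2_iff)
    then have "\<exists>x. e = {u, x}" using e by auto
    then show "e \<in> (\<lambda>x. {u, x}) ` {x. {u, x} \<in> E}" using e by auto
  qed auto
  moreover have "inj_on (\<lambda>x. {u, x}) A" for A by (auto simp: inj_on_def doubleton_eq_iff)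
  ultimately show ?thesis by (simp add: vertex_degree_def card_image)
qed

lemma vertex_degree_pos:
  fixes E :: "('v::finite) set set"
  assumes "CARD('v) \<ge> 2" "simple_graph E" "connected_graph E"
  shows "vertex_degree E u > 0"
proof -
  have "UNIV \<noteq> {u}"
  proof
    assume "UNIV = {u}"
    then have "CARD('v) = card {u}" by simp
    then show False using assms(1) by simp
  qed
  then obtain w where "w \<noteq> u" by auto
  then obtain x where "{u, x} \<in> E"
    using reach_last_exit[of u w E] assms(3) by (auto simp: connected_graph_def)
  then show ?thesis by (auto simp: vertex_degree_eq_card_neighbours[OF assms(2)] card_gt_0_iff)
qed

lemma laplacian_mult_sum:
  fixes E :: "('v::finite) set set"
  assumes E: "simple_graph E"
  shows "(\<Sum>x\<in>UNIV. (degree_matrix E - adjacency_matrix E) $ u $ x * f x) = (\<Sum>x | {u, x} \<in> E. f u - f x)"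
proof -
  have "(\<Sum>x\<in>UNIV. (degree_matrix E - adjacency_matrix E) $ u $ x * f x) =
      (\<Sum>x\<in>UNIV. (if u = x then real (vertex_degree E u) * f x else 0) - (if {u, x} \<in> E then f x else 0))"
    by (intro sum.cong) (auto simp: degree_matrix_def diag_matrix_def adjacency_matrix_def algebra_simps)
  also have "\<dots> = real (vertex_degree E u) * f u - (\<Sum>x | {u, x} \<in> E. f x)"
    by (simp add: sum_subtractf sum.If_cases)
  finally show ?thesis by (simp add: sum_subtractf vertex_degree_eq_card_neighbours[OF E])
qed

theorem corollary1p5:
  fixes E :: "('v::finite) set set" and u v :: 'v
  assumes "CARD('v) \<ge> 2"
    and "simple_graph E"
    and "connected_graph E"
  shows "normalized_green E $ u $ v =
    sqrt (real (vertex_degree E u) * real (vertex_degree E v)) /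
      ((real (vol E UNIV))\<^sup>2 * real (card (spanning_trees E))) *
    ((\<Sum>(F, T\<^sub>1, T\<^sub>2) \<in> {(F, T\<^sub>1, T\<^sub>2) \<in> named_2forests E. u \<in> T\<^sub>1 \<and> v \<in> T\<^sub>1}. (real (vol E T\<^sub>2))\<^sup>2)
     - (\<Sum>(F, T\<^sub>1, T\<^sub>2) \<in> {(F, T\<^sub>1, T\<^sub>2) \<in> named_2forests E. u \<in> T\<^sub>1 \<and> v \<in> T\<^sub>2}. real (vol E T\<^sub>1) * real (vol E T\<^sub>2)))"
proof -
  define d where "d u = real (vertex_degree E u)" for u
  define s where "s u = sqrt (d u)" for u
  define V where "V = real (vol E UNIV)"
  define t where "t = real (card (spanning_trees E))"
  let ?Lap = "degree_matrix E - adjacency_matrix E"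
  let ?L = "normalized_laplacian E"
  \<comment> \<open>The claimed inverse, and the orthogonal projection onto the line spanned by \<open>s\<close>.\<close>
  define X :: "real ^ 'v ^ 'v" where "X = (\<chi> u v. s u * s v / (V\<^sup>2 * t) * forest_kernel E u v)"
  define P :: "real ^ 'v ^ 'v" where "P = (\<chi> u v. s u * s v / V)"
  have d: "d u > 0" for u using vertex_degree_pos[OF assms] by (simp add: d_def)
  have s: "s u > 0" "s u * s u = d u" "s u \<noteq> 0" for u using d[of u] by (simp_all add: s_def)
  have "V = (\<Sum>u\<in>UNIV. d u)" by (simp add: V_def vol_def d_def)
  then have V: "V > 0" using d by (simp add: sum_pos)
  have "finite (spanning_trees E)" by simp
  then have t: "t > 0"
    using spanning_trees_nonempty[OF assms(2,3)] by (simp add: t_def card_gt_0_iff)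
  have L: "?L $ u $ v = ?Lap $ u $ v / (s u * s v)" for u v
    by (simp add: normalized_laplacian_def degree_matrix_inv_sqrt_def diag_matrix_conjugate
        s_def d_def)
  have Lap_sym: "?Lap $ u $ v = ?Lap $ v $ u" for u v
    by (simp add: degree_matrix_def diag_matrix_def adjacency_matrix_def insert_commute)
  have "moore_penrose ?L = X"
  proof (rule moore_penrose_eq_of_projection)
    show "transpose ?L = ?L"
      unfolding vec_eq_iff transpose_def using Lap_sym by (simp add: L mult.commute)
    show "transpose X = X"
      unfolding vec_eq_iff transpose_def by (auto simp: X_def mult.commute forest_kernel_commute)
    show "transpose P = P"
      by (simp add: vec_eq_iff transpose_def P_def mult.commute)
    show "?L ** X = mat 1 - P"
      unfolding vec_eq_iff
    proof (intro allI)
      fix u v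
      have "(?L ** X) $ u $ v =
          (\<Sum>x\<in>UNIV. s v / (s u * V\<^sup>2 * t) * (?Lap $ u $ x * forest_kernel E x v))"
        unfolding matrix_matrix_mult_def by (simp add: L X_def s(3) mult_ac)
      also have "\<dots> = s v / (s u * V\<^sup>2 * t) * (V * t * (V * of_bool (u = v) - d u))"
        unfolding sum_distrib_left[symmetric] laplacian_mult_sum[OF assms(2)]
          forest_kernel_laplacian[OF assms(2)] V_def t_def d_def ..
      also have "\<dots> = s v / s u * of_bool (u = v) - s u * s v / V"
        using V t s(1)[of u] unfolding s(2)[of u, symmetric]
        by (simp add: field_simps power2_eq_square)
      also have "\<dots> = (mat 1 - P) $ u $ v"
        using s(3) by (simp add: mat_def P_def)
      finally show "(?L ** X) $ u $ v = (mat 1 - P) $ u $ v" .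
    qed
    show "P ** ?L = 0"
      unfolding vec_eq_iff
    proof (intro allI)
      fix u v
      have "(P ** ?L) $ u $ v = (\<Sum>x\<in>UNIV. s u / (V * s v) * (?Lap $ v $ x * 1))"
        unfolding matrix_matrix_mult_def by (simp add: L P_def Lap_sym[of _ v, simplified] s(3) mult_ac)
      also have "\<dots> = 0"
        unfolding sum_distrib_left[symmetric] laplacian_mult_sum[OF assms(2)] by simp
      finally show "(P ** ?L) $ u $ v = 0 $ u $ v" by simp
    qed
    show "P ** X = 0"
      unfolding vec_eq_iff
    proof (intro allI)
      fix u v
      have "(P ** X) $ u $ v =
          (\<Sum>x\<in>UNIV. s u * s v / (V * (V\<^sup>2 * t)) * (d x * forest_kernel E x v))"
        unfolding matrix_matrix_mult_def by (simp add: P_def X_def s(2)[symmetric] mult_ac)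
      also have "\<dots> = 0"
        unfolding sum_distrib_left[symmetric] d_def forest_kernel_degree_orthogonal by simp
      finally show "(P ** X) $ u $ v = 0 $ u $ v" by simp
    qed
  qed
  then have "normalized_green E $ u $ v = s u * s v / (V\<^sup>2 * t) * forest_kernel E u v"
    by (simp add: normalized_green_def X_def)
  then show ?thesis
    unfolding forest_kernel_eq_named_sums by (simp add: s_def d_def V_def t_def real_sqrt_mult)
qed

end
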